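(* Let $G=(V,E)$ be an undirected graph with edge weights $w:E\to\{0,1,\dots,W\}$, let $r$ be a VC-SNDP requirement function with maximum requirement $k$, and let $t\ge1$ be an integer. Let $H$ be the output of the streaming greedy vertex-fault-tolerant spanner algorithm (described in the context) run on the edges of $G$ in an arbitrary order with parameters $t$, $f=(2t-2)(2k-1)$ and $\epsilon=1/(2t-1)$. Then the optimal value of the linear program VC-SNDP-LP on $(H,w,h)$ is at most $4t$ times the minimum weight of a feasible (integral) solution of the VC-SNDP instance $(G,r)$.
   Context: VC-SNDP: given $G=(V,E)$ with nonnegative edge weights and integers $r(uv)\ge0$ for unordered pairs, find a minimum-weight subgraph in which every pair $u,v$ has $r(uv)$ internally vertex-disjoint paths; we assume the instance on $G$ is feasible. A biset is a pair $\hat S=(S,S^+)$ with $S\subseteq S^+\subseteq V$. Define $h(\hat S)=\max\bigl(0,\max_{v\in S,\,u\in V\setminus S^+} r(u,v)-|S^+\setminus S|\bigr)$. For a graph $(V,E')$, VC-SNDP-LP$(E',w,h)$ is: minimize $\sum_{e\in E'} w(e)x(e)$ subject to $\sum_{uv\in E':\,u\in S,\,v\in V\setminus S^+} x(uv)\ge h(\hat S)$ for all bisets $\hat S=(S,S^+)$, and $x(e)\ge0$ for all $e\in E'$. Streaming greedy VFT spanner algorithm with parameters $(t,f,\epsilon)$: buckets $B_0=\{0\}$, $B_i=[(1+\epsilon)^{i-1},(1+\epsilon)^i)$ for $i=1,\dots,T$ covering $\{1,\dots,W\}$; start with $H_i=(V,\emptyset)$; for each arriving edge $(u,v)$ with $w(u,v)\in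 B_j$, add it to $H_j$ if there is a set $F\subseteq V\setminus\{u,v\}$ with $|F|\le f$ such that the unweighted (hop) distance between $u$ and $v$ in the subgraph of $H_j$ induced on $V\setminus F$ exceeds $2t-1$; output $H=\bigcup_i H_i$. *)

theory Defs
  imports Complex_Main "HOL-Library.Extended_Nat" "HOL-Library.Extended_Real" "HOL-Library.FuncSet"
begin

section \<open>Finite simple undirected graphs\<close>

definition simple_graph :: "'a set \<Rightarrow> 'a set set \<Rightarrow> bool" where
  "simple_graph V E \<longleftrightarrow> finite V \<and> (\<forall>e\<in>E. e \<subseteq> V \<and> card e = 2)"

definition induced_edges :: "'a set set \<Rightarrow> 'a set \<Rightarrow> 'a set set" where
  "induced_edges E U = {e \<in> E. e \<subseteq> U}"

definition is_path :: "'a set \<Rightarrow> 'a set set \<Rightarrow> 'a \<Rightarrow> 'a \<Rightarrow> 'a list \<Rightarrow> bool" where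
  "is_path V E u v p \<longleftrightarrow> p \<noteq> [] \<and> hd p = u \<and> last p = v \<and> distinct p \<and> set p \<subseteq> V \<and>
     successively (\<lambda>x y. {x, y} \<in> E) p"

definition hop_dist :: "'a set \<Rightarrow> 'a set set \<Rightarrow> 'a \<Rightarrow> 'a \<Rightarrow> enat" where
  "hop_dist V E u v = (INF p \<in> {p. is_path V E u v p}. enat (length p - 1))"

definition internal_vertices :: "'a list \<Rightarrow> 'a set" where
  "internal_vertices p = set (butlast (tl p))"

definition has_disjoint_paths :: "'a set \<Rightarrow> 'a set set \<Rightarrow> 'a \<Rightarrow> 'a \<Rightarrow> nat \<Rightarrow> bool" where
  "has_disjoint_paths V E u v m \<longleftrightarrow>
     (\<exists>P. finite P \<and> card P = m \<and> (\<forall>p\<in>P. is_path V E u v p) \<and>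
          pairwise (\<lambda>p q. internal_vertices p \<inter> internal_vertices q = {}) P)"

section \<open>VC-SNDP\<close>

text \<open>The requirement of the unordered pair \<open>uv\<close> is \<open>r {u, v}\<close>.\<close>

definition vc_sndp_feasible :: "'a set \<Rightarrow> ('a set \<Rightarrow> nat) \<Rightarrow> 'a set set \<Rightarrow> bool" where
  "vc_sndp_feasible V r F \<longleftrightarrow>
     (\<forall>u\<in>V. \<forall>v\<in>V. u \<noteq> v \<longrightarrow> has_disjoint_paths V F u v (r {u, v}))"

text \<open>Meaningful when the instance is feasible: \<open>Min\<close> is then taken over a finite nonempty set.\<close>

definition vc_sndp_opt :: "'a set \<Rightarrow> 'a set set \<Rightarrow> ('a set \<Rightarrow> real) \<Rightarrow> ('a set \<Rightarrow> nat) \<Rightarrow> real" where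
  "vc_sndp_opt V E w r = Min {\<Sum>e\<in>F. w e | F. F \<subseteq> E \<and> vc_sndp_feasible V r F}"

text \<open>The inserted \<open>0\<close> only matters when there is no pair of distinct vertices.\<close>

definition max_requirement :: "'a set \<Rightarrow> ('a set \<Rightarrow> nat) \<Rightarrow> nat" where
  "max_requirement V r = Max (insert 0 {r {u, v} | u v. u \<in> V \<and> v \<in> V \<and> u \<noteq> v})"

section \<open>Bisets and the linear program\<close>

type_synonym 'a biset = "'a set \<times> 'a set"

definition bisets :: "'a set \<Rightarrow> 'a biset set" where
  "bisets V = {(S, Sp). S \<subseteq> Sp \<and> Sp \<subseteq> V}"

text \<open>The inserted \<open>0\<close> renders the outer maximum with \<open>0\<close>; the value is \<open>0\<close> if
  \<open>S\<close> or \<open>V - Sp\<close> is empty.\<close>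

definition vc_deficiency :: "'a set \<Rightarrow> ('a set \<Rightarrow> nat) \<Rightarrow> 'a biset \<Rightarrow> int" where
  "vc_deficiency V r = (\<lambda>(S, Sp).
     Max (insert 0 {int (r {u, v}) - int (card (Sp - S)) | u v. v \<in> S \<and> u \<in> V - Sp}))"

definition biset_cut :: "'a set \<Rightarrow> 'a set set \<Rightarrow> 'a biset \<Rightarrow> 'a set set" where
  "biset_cut V E' = (\<lambda>(S, Sp). {e \<in> E'. \<exists>u\<in>S. \<exists>v\<in>V - Sp. e = {u, v}})"

definition vc_sndp_lp_feasible ::
  "'a set \<Rightarrow> 'a set set \<Rightarrow> ('a biset \<Rightarrow> int) \<Rightarrow> ('a set \<Rightarrow> real) \<Rightarrow> bool" where
  "vc_sndp_lp_feasible V E' h x \<longleftrightarrow>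
     (\<forall>B\<in>bisets V. (\<Sum>e\<in>biset_cut V E' B. x e) \<ge> real_of_int (h B)) \<and> (\<forall>e\<in>E'. x e \<ge> 0)"

text \<open>The infimum is taken in the extended reals, so an infeasible program has value \<open>\<infinity>\<close>.\<close>

definition vc_sndp_lp_opt ::
  "'a set \<Rightarrow> 'a set set \<Rightarrow> ('a set \<Rightarrow> real) \<Rightarrow> ('a biset \<Rightarrow> int) \<Rightarrow> ereal" where
  "vc_sndp_lp_opt V E' w h =
     (INF x \<in> {x. vc_sndp_lp_feasible V E' h x}. ereal (\<Sum>e\<in>E'. w e * x e))"

section \<open>The streaming greedy vertex-fault-tolerant spanner\<close>

fun bucket :: "real \<Rightarrow> nat \<Rightarrow> real set" where
  "bucket \<epsilon> 0 = {0}"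
| "bucket \<epsilon> (Suc i) = {(1 + \<epsilon>) ^ i ..< (1 + \<epsilon>) ^ Suc i}"

text \<open>The fault parameter is an integer because \<open>(2t - 2)(2k - 1)\<close> may be negative for \<open>k = 0\<close>.\<close>

definition vft_accepts :: "'a set \<Rightarrow> nat \<Rightarrow> int \<Rightarrow> 'a set set \<Rightarrow> 'a set \<Rightarrow> bool" where
  "vft_accepts V t f Hj e \<longleftrightarrow>
     (\<exists>u v F. e = {u, v} \<and> F \<subseteq> V - {u, v} \<and> int (card F) \<le> f \<and>
        hop_dist (V - F) (induced_edges Hj (V - F)) u v > enat (2 * t - 1))"

definition vft_step ::
  "'a set \<Rightarrow> ('a set \<Rightarrow> real) \<Rightarrow> nat \<Rightarrow> int \<Rightarrow> real \<Rightarrow> (nat \<Rightarrow> 'a set set) \<Rightarrow> 'a set \<Rightarrow> (nat \<Rightarrow> 'a set set)" where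
  "vft_step V w t f \<epsilon> H e =
     (\<lambda>j. if w e \<in> bucket \<epsilon> j \<and> vft_accepts V t f (H j) e then insert e (H j) else H j)"

definition streaming_vft_spanner ::
  "'a set \<Rightarrow> ('a set \<Rightarrow> real) \<Rightarrow> nat \<Rightarrow> nat \<Rightarrow> int \<Rightarrow> real \<Rightarrow> 'a set list \<Rightarrow> 'a set set" where
  "streaming_vft_spanner V w T t f \<epsilon> es =
     (\<Union>i\<le>T. foldl (vft_step V w t f \<epsilon>) (\<lambda>_. {}) es i)"

end

theory Submission imports Defs begin

text \<open>Let \<open>F\<close> be an optimal integral solution. An edge \<open>e\<close> of \<open>F\<close> missing from \<open>H\<close> was rejected, so
  in its bucket its ends stay within \<open>2t - 1\<close> hops after any \<open>(2t - 2)(2k - 1)\<close> vertex faults, and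
  hence are joined by \<open>2k\<close> internally disjoint paths of at most \<open>2t - 1\<close> hops, found greedily. Give
  every edge of \<open>F \<inter> H\<close> value \<open>1\<close> and, for every missing edge, add \<open>1/k\<close> along each of its \<open>2k\<close>
  paths. Each path costs at most \<open>(2t - 1)(1 + \<epsilon>) w(e) = 2t w(e)\<close>, so the total is at most
  \<open>4t w(F)\<close>. If a biset with boundary \<open>S\<^sup>+ - S\<close> has positive deficiency, the boundary has fewer than
  \<open>k\<close> vertices, so at least \<open>k\<close> of the \<open>2k\<close> paths of a missing cut edge avoid it and cross the
  biset: each edge of \<open>F\<close> in the cut is compensated by value at least \<open>1\<close>.\<close>

section \<open>Paths and bisets\<close>

fun path_edges :: "'a list \<Rightarrow> 'a set set" where
  "path_edges (x # y # p) = insert {x, y} (path_edges (y # p))"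
| "path_edges p = {}"

lemma finite_path_edges [simp]: "finite (path_edges p)"
  by (induction p rule: path_edges.induct) auto

lemma card_path_edges_le: "card (path_edges p) \<le> length p - 1"
proof (induction p rule: path_edges.induct)
  case (1 x y p)
  then show ?case
    using card_insert_le_m1[of "length (x # y # p) - 1" "path_edges (y # p)" "{x, y}"] by simp
qed auto

lemma path_edges_subset_iff:
  "path_edges p \<subseteq> E \<longleftrightarrow> successively (\<lambda>x y. {x, y} \<in> E) p"
  by (induction p rule: path_edges.induct) auto

lemma path_edges_subset_set: "e \<in> path_edges p \<Longrightarrow> e \<subseteq> set p"
  by (induction p rule: path_edges.induct) auto

text \<open>In a distinct list only the first edge contains the first vertex, and if the last vertex
  comes second, the list stops there. This serves to treat the one edge, joining the common ends,
  that internally disjoint paths might share.\<close>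

lemma path_edges_ends:
  assumes "distinct p" "{hd p, last p} \<in> path_edges p"
  shows "p = [hd p, last p]"
proof (cases p rule: path_edges.cases)
  case (1 x y q)
  have "{x, last p} \<notin> path_edges (y # q)"
    using path_edges_subset_set[of "{x, last p}" "y # q"] assms(1) 1 by auto
  then have "{x, last p} = {x, y}" using assms(2) 1 by simp
  then have "last p = y" using assms(1) 1 by (metis doubleton_eq_iff)
  then have "q = []" using assms(1) 1 by (metis distinct.simps(2) last.simps last_in_set list.distinct(1))
  then show ?thesis using 1 by simp
qed (use assms in auto)

text \<open>Somewhere along the list membership in \<open>S\<close> changes. Of the two vertices
  there, the one outside \<open>S\<close> is also outside \<open>Sp\<close>, because the list avoids
  \<open>Sp - S\<close>; so the edge between them is a cut edge. The direction of the change is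
  irrelevant, since edges are unordered.\<close>

lemma path_edges_cross_biset:
  assumes "p \<noteq> []" "set p \<subseteq> V" "path_edges p \<subseteq> E" "set p \<inter> (Sp - S) = {}"
    and "(hd p \<in> S) \<noteq> (last p \<in> S)"
  shows "path_edges p \<inter> biset_cut V E (S, Sp) \<noteq> {}"
  using assms
proof (induction p rule: path_edges.induct)
  case (1 x y p)
  show ?case
  proof (cases "(x \<in> S) = (y \<in> S)")
    case True
    then show ?thesis using 1 by auto
  next
    case False
    then have "{x, y} \<in> biset_cut V E (S, Sp)"
      using 1(3-5) by (auto simp: biset_cut_def)
    then show ?thesis by auto
  qed
qed auto

section \<open>Vertices and interiors of paths\<close>

lemma is_path_path_edges: "is_path V E u v p \<Longrightarrow> path_edges p \<subseteq> E"
  by (simp add: is_path_def path_edges_subset_iff)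

lemma is_path_set:
  assumes "is_path V E u v p"
  shows "set p = {u, v} \<union> internal_vertices p"
proof (cases p)
  case Nil
  then show ?thesis using assms by (simp add: is_path_def)
next
  case (Cons a q)
  show ?thesis
  proof (cases q rule: rev_cases)
    case Nil
    then show ?thesis using assms Cons by (auto simp: is_path_def internal_vertices_def)
  next
    case (snoc q' b)
    then show ?thesis using assms Cons by (auto simp: is_path_def internal_vertices_def)
  qed
qed

lemma is_path_internal_vertices:
  assumes "is_path V E u v p"
  shows "u \<notin> internal_vertices p" "v \<notin> internal_vertices p"
    "card (internal_vertices p) \<le> length p - 2" "internal_vertices p \<subseteq> V"
proof -
  have d: "p \<noteq> []" "distinct p" "hd p = u" "last p = v" "set p \<subseteq> V"
    using assms by (auto simp: is_path_def)
  show "u \<notin> internal_vertices p"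
    using d by (cases p) (auto simp: internal_vertices_def dest: in_set_butlastD)
  show "v \<notin> internal_vertices p"
  proof (cases "tl p" rule: rev_cases)
    case (snoc q b)
    then have "last p = b" using d(1) by (metis last_snoc last_tl snoc_eq_iff_butlast)
    then show ?thesis
      using d snoc distinct_tl[OF d(2)] by (auto simp: internal_vertices_def)
  qed (simp add: internal_vertices_def)
  show "card (internal_vertices p) \<le> length p - 2"
    using card_length[of "butlast (tl p)"] by (simp add: internal_vertices_def)
  show "internal_vertices p \<subseteq> V"
    using is_path_set[OF assms] d by auto
qed

lemma is_path_mono:
  assumes "is_path V E u v p" "V \<subseteq> V'" "E \<subseteq> E'"
  shows "is_path V' E' u v p"
  using assms by (auto simp: is_path_def elim: successively_mono)

section \<open>Disjoint paths against boundaries and cuts\<close>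

text \<open>Choose on each path that meets \<open>X\<close> a vertex of \<open>X\<close>. It is
  internal, as \<open>X\<close> contains neither end, so disjointness of the interiors makes the
  choice injective.\<close>

lemma card_paths_hitting_le:
  assumes "finite P" "\<forall>p\<in>P. is_path V E u v p"
    and "pairwise (\<lambda>p q. internal_vertices p \<inter> internal_vertices q = {}) P"
    and "finite X" "u \<notin> X" "v \<notin> X"
  shows "card {p \<in> P. set p \<inter> X \<noteq> {}} \<le> card X"
proof -
  define g where "g p = (SOME x. x \<in> set p \<inter> X)" for p
  have g: "g p \<in> set p \<inter> X" if "set p \<inter> X \<noteq> {}" for p
    unfolding g_def using that by (intro someI_ex[of "\<lambda>x. x \<in> set p \<inter> X"]) auto
  have gi: "g p \<in> internal_vertices p \<inter> X" if "p \<in> P" "set p \<inter> X \<noteq> {}" for p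
    using g[OF that(2)] is_path_set[of V E u v p] assms that by auto
  have "inj_on g {p \<in> P. set p \<inter> X \<noteq> {}}"
  proof (rule inj_onI)
    fix p q assume pq: "p \<in> {p \<in> P. set p \<inter> X \<noteq> {}}" "q \<in> {p \<in> P. set p \<inter> X \<noteq> {}}" "g p = g q"
    then have "g p \<in> internal_vertices p \<inter> internal_vertices q"
      using gi[of p] gi[of q] by auto
    then show "p = q" using pq assms(3) unfolding pairwise_def by blast
  qed
  then show ?thesis
    using g assms(4) by (intro card_inj_on_le[of g]) auto
qed

text \<open>The paths have only \<open>u\<close> and \<open>v\<close> in common, so a shared
  two-element edge is \<open>{u, v}\<close>, and then each path consists of that edge alone.\<close>

lemma disjoint_paths_edge_disjoint:
  assumes p: "is_path V E u v p" and q: "is_path V E u v q"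
    and disj: "internal_vertices p \<inter> internal_vertices q = {}"
    and e: "e \<in> path_edges p" "e \<in> path_edges q" "card e = 2"
  shows "p = q"
proof -
  have "e \<subseteq> set p \<inter> set q" using e path_edges_subset_set by blast
  then have "e \<subseteq> {u, v}"
    using is_path_set[OF p] is_path_set[OF q] disj
      is_path_internal_vertices(1,2)[OF p] is_path_internal_vertices(1,2)[OF q] by auto
  then have "e = {u, v}"
    using e(3) card_seteq[of "{u, v}" e] card_insert_le_m1[of 2 "{v}" u] by simp
  then show ?thesis
    using path_edges_ends[of p] path_edges_ends[of q] p q e by (simp add: is_path_def)
qed

text \<open>The easy direction of Menger's theorem for bisets: at most \<open>card (Sp - S)\<close>
  of the \<open>m\<close> paths meet the boundary, and each of the others crosses the cut in an edge
  of its own.\<close>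

lemma card_biset_cut_ge:
  assumes "has_disjoint_paths V F u v m" and FV: "\<forall>e\<in>F. card e = 2" "finite F" and "finite Sp"
    and uv: "u \<notin> Sp" "v \<in> S" "S \<subseteq> Sp"
  shows "m \<le> card (biset_cut V F (S, Sp)) + card (Sp - S)"
proof -
  obtain P where P: "finite P" "card P = m" "\<forall>p\<in>P. is_path V F u v p"
    "pairwise (\<lambda>p q. internal_vertices p \<inter> internal_vertices q = {}) P"
    using assms(1) unfolding has_disjoint_paths_def by auto
  define X where "X = Sp - S"
  define C where "C = biset_cut V F (S, Sp)"
  define A where "A = {p \<in> P. set p \<inter> X = {}}"
  have "card {p \<in> P. set p \<inter> X \<noteq> {}} \<le> card X"
    using uv assms(4) P by (intro card_paths_hitting_le) (auto simp: X_def)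
  moreover have "card A + card {p \<in> P. set p \<inter> X \<noteq> {}} = m"
    using card_Int_Diff[OF P(1), of "{p. set p \<inter> X = {}}"] P(2)
    by (simp add: A_def Int_def set_diff_eq)
  moreover have "card A \<le> card C"
  proof -
    have "\<forall>p\<in>A. \<exists>e. e \<in> path_edges p \<inter> C"
    proof
      fix p assume "p \<in> A"
      then have "is_path V F u v p" "set p \<inter> X = {}" using P by (auto simp: A_def)
      then show "\<exists>e. e \<in> path_edges p \<inter> C"
        using path_edges_cross_biset[of p V F Sp S] is_path_path_edges[of V F u v p] uv
        by (auto simp: is_path_def X_def C_def)
    qed
    then obtain g where g: "\<forall>p\<in>A. g p \<in> path_edges p \<inter> C" by metis
    have CF: "C \<subseteq> F" by (auto simp: C_def biset_cut_def)
    have "inj_on g A"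
    proof (rule inj_onI, rule ccontr)
      fix p q assume pq: "p \<in> A" "q \<in> A" "g p = g q" "p \<noteq> q"
      then have "internal_vertices p \<inter> internal_vertices q = {}"
        using P(4) by (auto simp: A_def pairwise_def)
      moreover have "g p \<in> path_edges p" "g p \<in> path_edges q" "card (g p) = 2"
        using g pq FV(1) CF by (metis IntE subsetD)+
      moreover have "is_path V F u v p" "is_path V F u v q" using pq P(3) by (auto simp: A_def)
      ultimately show False using disjoint_paths_edge_disjoint pq(4) by metis
    qed
    then show ?thesis
      using g FV(2) CF finite_subset by (intro card_inj_on_le[of g]) auto
  qed
  ultimately show ?thesis by (simp add: X_def C_def)
qed

section \<open>The greedy spanner\<close>

lemma vft_fold_bucket:
  "foldl (vft_step V w t f \<epsilon>) (\<lambda>_. {}) es j \<subseteq> {e \<in> set es. w e \<in> bucket \<epsilon> j}"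
  by (induction es rule: rev_induct) (auto simp: vft_step_def)

text \<open>\<open>H'\<close> is the content of bucket \<open>j\<close> just before an arrival of
  \<open>e\<close>. Edges are only ever inserted, so whatever is found in \<open>H'\<close> survives
  in the final bucket.\<close>

lemma vft_fold_rejected:
  assumes "e \<in> set es" "w e \<in> bucket \<epsilon> j"
    and "e \<notin> foldl (vft_step V w t f \<epsilon>) (\<lambda>_. {}) es j"
  shows "\<exists>H' \<subseteq> foldl (vft_step V w t f \<epsilon>) (\<lambda>_. {}) es j. \<not> vft_accepts V t f H' e"
  using assms
proof (induction es rule: rev_induct)
  case (snoc a es)
  let ?H = "foldl (vft_step V w t f \<epsilon>) (\<lambda>_. {}) es"
  have mono: "?H j \<subseteq> foldl (vft_step V w t f \<epsilon>) (\<lambda>_. {}) (es @ [a]) j"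
    by (auto simp: vft_step_def)
  show ?case
  proof (cases "e = a")
    case True
    then have "\<not> vft_accepts V t f (?H j) e"
      using snoc.prems by (auto simp: vft_step_def[of _ _ _ _ _ ?H])
    then show ?thesis using mono by blast
  next
    case False
    then have "e \<in> set es" "e \<notin> ?H j" using snoc.prems mono by auto
    then show ?thesis using snoc.IH snoc.prems(2) mono by blast
  qed
qed simp

section \<open>From rejection to disjoint short paths\<close>

lemma hop_dist_le_enatD:
  assumes "hop_dist V E u v \<le> enat n"
  obtains p where "is_path V E u v p" "length p - 1 \<le> n"
proof -
  have "\<exists>p. is_path V E u v p \<and> length p - 1 \<le> n"
  proof (rule ccontr)
    assume "\<not> ?thesis"
    then have "enat (Suc n) \<le> hop_dist V E u v"
      unfolding hop_dist_def by (intro INF_greatest) (auto simp: not_le Suc_le_eq)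
    then have "enat (Suc n) \<le> enat n" using assms order_trans by blast
    then show False by simp
  qed
  then show ?thesis using that by blast
qed

text \<open>Greedy choice: the internal vertices of the paths found so far form a fault set, and
  rejection yields a further short path avoiding it. The last of the \<open>n\<close> paths has to
  avoid \<open>n - 1\<close> earlier ones, whence the factor \<open>int n - 1\<close>; for
  \<open>n = 0\<close> nothing is asked of \<open>f\<close>, which may be negative.\<close>

lemma rejected_disjoint_short_paths:
  assumes "finite V" "u \<noteq> v" "{u, v} \<notin> H" "t \<ge> 1"
    and rej: "\<not> vft_accepts V t f H {u, v}"
    and "n = 0 \<or> (2 * int t - 2) * (int n - 1) \<le> f"
  shows "\<exists>P. finite P \<and> card P = n \<and> (\<forall>p\<in>P. is_path V H u v p \<and> length p \<le> 2 * t) \<and>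
    pairwise (\<lambda>p q. internal_vertices p \<inter> internal_vertices q = {}) P"
  using assms(6)
proof (induction n)
  case 0
  show ?case by (intro exI[of _ "{}"]) auto
next
  case (Suc n)
  have fn: "(2 * int t - 2) * int n \<le> f" using Suc.prems by simp
  moreover have "(2 * int t - 2) * (int n - 1) \<le> (2 * int t - 2) * int n"
    using assms(4) by (intro mult_left_mono) auto
  ultimately obtain P where P: "finite P" "card P = n"
    "\<forall>p\<in>P. is_path V H u v p \<and> length p \<le> 2 * t"
    "pairwise (\<lambda>p q. internal_vertices p \<inter> internal_vertices q = {}) P"
    using Suc.IH by force
  define X where "X = (\<Union>p\<in>P. internal_vertices p)"
  have XV: "X \<subseteq> V - {u, v}"
    using P(3) is_path_internal_vertices unfolding X_def by fastforce
  have "card X \<le> (\<Sum>p\<in>P. card (internal_vertices p))"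
    unfolding X_def using P(1) by (rule card_UN_le)
  \<comment> \<open>A path with at most \<open>2 * t\<close> vertices has at most
    \<open>2 * t - 2\<close> internal ones; this keeps \<open>X\<close> within the fault
    budget.\<close>
  also have "\<dots> \<le> (\<Sum>p\<in>P. 2 * t - 2)"
    using P(3) by (intro sum_mono order_trans[OF is_path_internal_vertices(3)]) auto
  also have "\<dots> = n * (2 * t - 2)" using P(2) by simp
  finally have "int (card X) \<le> int (n * (2 * t - 2))" by (simp only: of_nat_le_iff)
  also have "\<dots> = (2 * int t - 2) * int n" using assms(4) by (simp add: of_nat_diff)
  finally have "int (card X) \<le> f" using fn by linarith
  then have "hop_dist (V - X) (induced_edges H (V - X)) u v \<le> enat (2 * t - 1)"
    using rej XV not_le unfolding vft_accepts_def by blast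
  then obtain p where p: "is_path (V - X) (induced_edges H (V - X)) u v p" "length p - 1 \<le> 2 * t - 1"
    by (rule hop_dist_le_enatD)
  have pV: "is_path V H u v p"
    using p(1) by (rule is_path_mono) (auto simp: induced_edges_def)
  have pX: "internal_vertices p \<inter> X = {}" using is_path_internal_vertices(4)[OF p(1)] by auto
  \<comment> \<open>Disjointness from \<open>X\<close> alone does not make \<open>p\<close> new,
    since a path without interior could be in \<open>P\<close> already. Such a path would be the
    edge \<open>{u, v}\<close>, which is not in \<open>H\<close>.\<close>
  have ne: "internal_vertices p \<noteq> {}"
  proof
    assume "internal_vertices p = {}"
    then have "p = [] \<or> tl p = [] \<or> length (tl p) = 1"
      by (cases "tl p" rule: rev_cases) (auto simp: internal_vertices_def)
    then obtain a b where "p = [] \<or> p = [a] \<or> p = [a, b]"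
      by (cases p) (auto simp: length_Suc_conv)
    then show False using pV assms(2,3) by (auto simp: is_path_def)
  qed
  then have "p \<notin> P" using pX by (auto simp: X_def)
  moreover have "pairwise (\<lambda>p q. internal_vertices p \<inter> internal_vertices q = {}) (insert p P)"
    using P(4) pX by (auto simp: pairwise_insert X_def)
  moreover have "length p \<le> 2 * t" using p(2) assms(4) by linarith
  ultimately show ?case
    using P pV by (intro exI[of _ "insert p P"]) auto
qed

lemma bucket_ratio:
  assumes "x \<in> bucket \<epsilon> j" "y \<in> bucket \<epsilon> j" "\<epsilon> \<ge> 0"
  shows "y \<le> (1 + \<epsilon>) * x"
proof (cases j)
  case (Suc i)
  then have "(1 + \<epsilon>) * (1 + \<epsilon>) ^ i \<le> (1 + \<epsilon>) * x"
    using assms by (intro mult_left_mono) auto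
  then show ?thesis using assms(2) Suc by auto
qed (use assms in auto)

text \<open>The value of \<open>f\<close> is exactly the budget that the greedy choice of
  \<open>2 * k\<close> paths requires.\<close>

lemma spanner_replacement_paths:
  assumes G: "simple_graph V E" and w: "w \<in> E \<rightarrow> real ` {0..W}" and "t \<ge> 1" "k \<ge> 1"
    and f: "f = (2 * int t - 2) * (2 * int k - 1)"
    and \<epsilon>: "\<epsilon> = 1 / (2 * real t - 1)"
    and cover: "real ` {1..W} \<subseteq> (\<Union>i\<in>{1..T}. bucket \<epsilon> i)"
    and es: "set es = E" and H: "H = streaming_vft_spanner V w T t f \<epsilon> es"
    and e: "e \<in> E - H"
  shows "\<exists>P u v. e = {u, v} \<and> finite P \<and> card P = 2 * k \<and>
    (\<forall>p\<in>P. is_path V H u v p \<and> (\<Sum>e'\<in>path_edges p. w e') \<le> 2 * real t * w e) \<and>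
    pairwise (\<lambda>p q. internal_vertices p \<inter> internal_vertices q = {}) P"
proof -
  have \<epsilon>0: "\<epsilon> \<ge> 0" using \<epsilon> \<open>t \<ge> 1\<close> by simp
  obtain n where n: "w e = real n" "n \<le> W" using w e by (auto simp: Pi_iff)
  \<comment> \<open>Weight 0 has bucket 0 to itself; \<open>cover\<close> speaks of the positive
    weights only.\<close>
  have "\<exists>j\<le>T. w e \<in> bucket \<epsilon> j"
  proof (cases "n = 0")
    case True
    then show ?thesis using n by (intro exI[of _ 0]) auto
  next
    case False
    then have "w e \<in> real ` {1..W}" using n by auto
    then show ?thesis using cover by fastforce
  qed
  then obtain j where j: "j \<le> T" "w e \<in> bucket \<epsilon> j" by blast
  define Hj where "Hj = foldl (vft_step V w t f \<epsilon>) (\<lambda>_. {}) es j"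
  have HjH: "Hj \<subseteq> H" using j(1) by (auto simp: H streaming_vft_spanner_def Hj_def)
  then obtain H' where H': "H' \<subseteq> Hj" "\<not> vft_accepts V t f H' e"
    using vft_fold_rejected[of e es w \<epsilon> j V t f] e es j(2) unfolding Hj_def by blast
  obtain u v where uv: "e = {u, v}" "u \<noteq> v"
    using G e by (auto simp: simple_graph_def card_2_iff)
  have "finite V" using G by (simp add: simple_graph_def)
  then obtain P where P: "finite P" "card P = 2 * k"
    "\<forall>p\<in>P. is_path V H' u v p \<and> length p \<le> 2 * t"
    "pairwise (\<lambda>p q. internal_vertices p \<inter> internal_vertices q = {}) P"
    using rejected_disjoint_short_paths[of V u v H' t f "2 * k"] uv H' HjH e \<open>t \<ge> 1\<close> f by auto
  have "(\<Sum>e'\<in>path_edges p. w e') \<le> 2 * real t * w e" if "p \<in> P" for p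
  proof -
    have p: "is_path V H' u v p" "length p \<le> 2 * t" using P that by auto
    have "w e' \<le> (1 + \<epsilon>) * w e" if "e' \<in> path_edges p" for e'
    proof -
      \<comment> \<open>The paths stay inside the bucket of \<open>e\<close>, so their edges are
        heavier than \<open>e\<close> by a factor of at most \<open>1 + \<epsilon>\<close>.\<close>
      have "e' \<in> Hj" using that is_path_path_edges[OF p(1)] H' by auto
      then have "w e' \<in> bucket \<epsilon> j" using vft_fold_bucket unfolding Hj_def by blast
      then show ?thesis using bucket_ratio j(2) \<epsilon>0 by blast
    qed
    then have "(\<Sum>e'\<in>path_edges p. w e') \<le> real (card (path_edges p)) * ((1 + \<epsilon>) * w e)"
      by (rule sum_bounded_above)
    also have "\<dots> \<le> (2 * real t - 1) * ((1 + \<epsilon>) * w e)"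
    proof (rule mult_right_mono)
      show "real (card (path_edges p)) \<le> 2 * real t - 1"
        using card_path_edges_le[of p] p(2) \<open>t \<ge> 1\<close> by linarith
      show "0 \<le> (1 + \<epsilon>) * w e" using \<epsilon>0 n by simp
    qed
    \<comment> \<open>The choice of \<open>\<epsilon>\<close> makes
      \<open>(2 * real t - 1) * (1 + \<epsilon>)\<close> equal to \<open>2 * real t\<close>.\<close>
    also have "\<dots> = 2 * real t * w e" using \<open>t \<ge> 1\<close> by (simp add: \<epsilon> field_simps)
    finally show ?thesis .
  qed
  moreover have "\<forall>p\<in>P. is_path V H u v p" 
    using P(3) is_path_mono[of V H' u v _ V H] H' HjH by blast
  ultimately show ?thesis using uv P by blast
qed

section \<open>The fractional solution\<close>

text \<open>This is where twice \<open>k\<close> paths are used: a boundary of at most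
  \<open>k\<close> vertices spoils at most \<open>k\<close> of them, and every other path joins the
  two sides of the biset and so has a cut edge.\<close>

lemma card_path_crossings_ge:
  assumes P: "finite P" "card P = 2 * k" "\<forall>p\<in>P. is_path V H u v p"
    "pairwise (\<lambda>p q. internal_vertices p \<inter> internal_vertices q = {}) P"
    and "{u, v} \<in> biset_cut V F (S, Sp)" "finite Sp" "S \<subseteq> Sp" "card (Sp - S) \<le> k"
  shows "k \<le> card {p \<in> P. path_edges p \<inter> biset_cut V H (S, Sp) \<noteq> {}}"
proof -
  \<comment> \<open>The unordered cut edge does not reveal which end lies in \<open>S\<close>, so
    both cases are carried along.\<close>
  have uv: "u \<in> S \<and> v \<notin> Sp \<or> v \<in> S \<and> u \<notin> Sp"
    using assms(5) by (auto simp: biset_cut_def doubleton_eq_iff)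
  define X where "X = Sp - S"
  have "card {p \<in> P. set p \<inter> X \<noteq> {}} \<le> card X"
    using uv assms by (intro card_paths_hitting_le) (auto simp: X_def)
  moreover have "card P = card {p \<in> P. set p \<inter> X = {}} + card {p \<in> P. set p \<inter> X \<noteq> {}}"
    using card_Int_Diff[OF P(1), of "{p. set p \<inter> X = {}}"] by (simp add: Int_def set_diff_eq)
  moreover have "card {p \<in> P. set p \<inter> X = {}} 
      \<le> card {p \<in> P. path_edges p \<inter> biset_cut V H (S, Sp) \<noteq> {}}"
  proof (rule card_mono)
    show "{p \<in> P. set p \<inter> X = {}} \<subseteq> {p \<in> P. path_edges p \<inter> biset_cut V H (S, Sp) \<noteq> {}}"
    proof safe
      fix p assume p: "p \<in> P" "set p \<inter> X = {}" "path_edges p \<inter> biset_cut V H (S, Sp) = {}"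
      then have ip: "is_path V H u v p" using P by blast
      then have "(hd p \<in> S) \<noteq> (last p \<in> S)" using uv \<open>S \<subseteq> Sp\<close> by (auto simp: is_path_def)
      then show False
        using path_edges_cross_biset[of p V H Sp S] is_path_path_edges[OF ip] ip p
        by (auto simp: is_path_def X_def)
    qed
  qed (use P in auto)
  ultimately show ?thesis using assms(2,8) by (simp add: X_def)
qed

text \<open>The maximum over a finite set is attained, so a positive deficiency can be charged to a
  single pair and its disjoint paths.\<close>

lemma vc_deficiency_cases:
  assumes "finite V" "(S, Sp) \<in> bisets V"
  shows "vc_deficiency V r (S, Sp) = 0 \<or>
    (\<exists>u v. v \<in> S \<and> u \<in> V - Sp \<and> vc_deficiency V r (S, Sp) = int (r {u, v}) - int (card (Sp - S)))"
proof -
  let ?A = "{int (r {u, v}) - int (card (Sp - S)) | u v. v \<in> S \<and> u \<in> V - Sp}"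
  have "finite S" using assms by (auto simp: bisets_def intro: finite_subset)
  moreover have "?A = (\<lambda>(u, v). int (r {u, v}) - int (card (Sp - S))) ` ((V - Sp) \<times> S)" by auto
  ultimately have "finite ?A" using assms(1) by simp
  then have "Max (insert 0 ?A) \<in> insert 0 ?A" by (intro Max_in) auto
  then show ?thesis unfolding vc_deficiency_def by auto
qed

lemma requirement_le_max_requirement:
  assumes "finite V" "u \<in> V" "v \<in> V" "u \<noteq> v"
  shows "r {u, v} \<le> max_requirement V r"
proof -
  let ?A = "{r {u, v} | u v. u \<in> V \<and> v \<in> V \<and> u \<noteq> v}"
  have "?A \<subseteq> (\<lambda>(u, v). r {u, v}) ` (V \<times> V)" by auto
  then have "finite ?A" using assms(1) by (meson finite_SigmaI finite_imageI finite_subset)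
  then show ?thesis
    unfolding max_requirement_def using assms by (intro Max_ge) auto
qed

text \<open>The deficiency is at most the number of edges of \<open>F\<close> in the cut. Those in
  \<open>H\<close> carry value 1 themselves; each of the others sends \<open>1 / k\<close> along at
  least \<open>k\<close> crossing paths. Lengths and weights do not enter, so the path families are
  arbitrary here.\<close>

lemma lp_feasible_by_replacement:
  fixes P :: "'a set \<Rightarrow> 'a list set"
  assumes "finite V" and F: "finite F" "\<forall>e\<in>F. card e = 2" "vc_sndp_feasible V r F"
    and k: "k = max_requirement V r" and "finite H"
    and P: "\<And>e. e \<in> F - H \<Longrightarrow> \<exists>u v. e = {u, v} \<and> finite (P e) \<and> card (P e) = 2 * k \<and>
      (\<forall>p\<in>P e. is_path V H u v p) \<and>
      pairwise (\<lambda>p q. internal_vertices p \<inter> internal_vertices q = {}) (P e)"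
  shows "vc_sndp_lp_feasible V H (vc_deficiency V r)
    (\<lambda>e'. of_bool (e' \<in> F) + (\<Sum>e\<in>F - H. \<Sum>p\<in>P e. of_bool (e' \<in> path_edges p)) / real k)"
    (is "vc_sndp_lp_feasible V H _ ?x")
proof -
  have x0: "?x e' \<ge> 0" for e' by (intro add_nonneg_nonneg divide_nonneg_nonneg sum_nonneg) auto
  have "real_of_int (vc_deficiency V r (S, Sp)) \<le> (\<Sum>e\<in>biset_cut V H (S, Sp). ?x e)"
    if B: "(S, Sp) \<in> bisets V" for S Sp
  proof (cases "vc_deficiency V r (S, Sp) \<le> 0")
    case True
    have "0 \<le> (\<Sum>e\<in>biset_cut V H (S, Sp). ?x e)" by (intro sum_nonneg x0)
    then show ?thesis using True by (smt (verit) of_int_le_0_iff)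
  next
    case False
    then obtain u v where uv: "v \<in> S" "u \<in> V - Sp"
      and h: "vc_deficiency V r (S, Sp) = int (r {u, v}) - int (card (Sp - S))"
      using vc_deficiency_cases[OF assms(1) B, of r] by auto
    have SV: "S \<subseteq> Sp" "Sp \<subseteq> V" "finite Sp"
      using B assms(1) by (auto simp: bisets_def intro: finite_subset)
    have "u \<in> V" "v \<in> V" "u \<noteq> v" using uv SV by auto
    then have "r {u, v} \<le> k" and paths: "has_disjoint_paths V F u v (r {u, v})"
      using requirement_le_max_requirement[OF assms(1), of u v r] F(3) k
      by (auto simp: vc_sndp_feasible_def)
    \<comment> \<open>A positive deficiency puts the boundary size below \<open>r {u, v}\<close>,
      hence below \<open>k\<close>; in particular \<open>k\<close> is positive and may be divided
      by.\<close>
    then have Xk: "card (Sp - S) \<le> k" "k \<ge> 1" using False h by auto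
    define CF where "CF = biset_cut V F (S, Sp)"
    define CH where "CH = biset_cut V H (S, Sp)"
    have CF: "CF \<subseteq> F" "finite CF" and CH: "CH \<subseteq> H" "finite CH"
      using F(1) \<open>finite H\<close> by (auto simp: CF_def CH_def biset_cut_def)
    have "r {u, v} \<le> card CF + card (Sp - S)"
      unfolding CF_def using card_biset_cut_ge[OF paths F(2,1)] SV uv by auto
    then have "real_of_int (vc_deficiency V r (S, Sp)) \<le> real (card CF)" using h by linarith
    also have "\<dots> = real (card (CF \<inter> H)) + real (card (CF - H))"
      using CF(2) by (metis card_Diff_subset_Int card_Int_Diff of_nat_add)
    also have "\<dots> \<le> (\<Sum>e'\<in>CH. of_bool (e' \<in> F)) +
        (\<Sum>e\<in>F - H. \<Sum>p\<in>P e. \<Sum>e'\<in>CH. of_bool (e' \<in> path_edges p)) / real k"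
    proof (rule add_mono)
      have "CF \<inter> H = CH \<inter> {e'. e' \<in> F}" by (auto simp: CF_def CH_def biset_cut_def)
      then show "real (card (CF \<inter> H)) \<le> (\<Sum>e'\<in>CH. of_bool (e' \<in> F))" using CH by (simp add: Int_def)
      have "real k \<le> (\<Sum>p\<in>P e. \<Sum>e'\<in>CH. of_bool (e' \<in> path_edges p))" if e: "e \<in> CF - H" for e
      proof -
        have "e \<in> F - H" using e CF by auto
        from P[OF this] obtain a b where ab: "e = {a, b}" "finite (P e)" "card (P e) = 2 * k"
          "\<forall>p\<in>P e. is_path V H a b p"
          "pairwise (\<lambda>p q. internal_vertices p \<inter> internal_vertices q = {}) (P e)" by blast
        have "k \<le> card {p \<in> P e. path_edges p \<inter> CH \<noteq> {}}"
          unfolding CH_def using e ab(1) SV Xk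
          by (intro card_path_crossings_ge[OF ab(2-5), of F]) (auto simp: CF_def)
        then have "real k \<le> (\<Sum>p\<in>P e. of_bool (path_edges p \<inter> CH \<noteq> {}))"
          using ab(2) by (simp add: Int_def)
        also have "\<dots> \<le> (\<Sum>p\<in>P e. \<Sum>e'\<in>CH. of_bool (e' \<in> path_edges p))"
        proof (rule sum_mono)
          fix p
          show "(of_bool (path_edges p \<inter> CH \<noteq> {}) :: real) \<le> (\<Sum>e'\<in>CH. of_bool (e' \<in> path_edges p))"
          proof (cases "path_edges p \<inter> CH = {}")
            case False
            then obtain c where "c \<in> CH" "c \<in> path_edges p" by auto
            then show ?thesis
              using member_le_sum[of c CH "\<lambda>e'. of_bool (e' \<in> path_edges p) :: real"] CH by auto
          qed (simp add: sum_nonneg)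
        qed
        finally show ?thesis .
      qed
      then have "real (card (CF - H)) * real k \<le>
          (\<Sum>e\<in>CF - H. \<Sum>p\<in>P e. \<Sum>e'\<in>CH. of_bool (e' \<in> path_edges p))"
        by (intro sum_bounded_below)
      \<comment> \<open>Paths replacing edges outside the cut can only add value.\<close>
      also have "\<dots> \<le> (\<Sum>e\<in>F - H. \<Sum>p\<in>P e. \<Sum>e'\<in>CH. of_bool (e' \<in> path_edges p))"
        using F(1) CF by (intro sum_mono2) (auto intro!: sum_nonneg)
      finally show "real (card (CF - H)) \<le>
          (\<Sum>e\<in>F - H. \<Sum>p\<in>P e. \<Sum>e'\<in>CH. of_bool (e' \<in> path_edges p)) / real k"
        using Xk(2) by (simp add: field_simps)
    qed
    \<comment> \<open>Exchanging the sums turns the count per path into the value per cut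
      edge.\<close>
    also have "\<dots> = (\<Sum>e'\<in>CH. ?x e')"
      by (simp only: sum.distrib sum_divide_distrib[symmetric] sum.swap[of _ _ CH])
    finally show ?thesis unfolding CH_def .
  qed
  then show ?thesis unfolding vc_sndp_lp_feasible_def using x0 by auto
qed

text \<open>Summing by replaced edge instead of by edge of \<open>H\<close>, each \<open>e\<close>
  in \<open>F - H\<close> pays \<open>1 / k\<close> for each of \<open>2 * k\<close> paths of cost
  at most \<open>c * w e\<close>, together at most \<open>2 * c * w e\<close>.\<close>

lemma lp_cost_by_replacement:
  fixes P :: "'a set \<Rightarrow> 'a list set" and w :: "'a set \<Rightarrow> real"
  assumes "finite F" "finite H" "k \<ge> 1" "c \<ge> 1" and w0: "\<forall>e\<in>F. w e \<ge> 0"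
    and P: "\<And>e p. e \<in> F - H \<Longrightarrow> p \<in> P e \<Longrightarrow>
      path_edges p \<subseteq> H \<and> (\<Sum>e'\<in>path_edges p. w e') \<le> c * w e"
    and card: "\<And>e. e \<in> F - H \<Longrightarrow> card (P e) = 2 * k"
  shows "(\<Sum>e'\<in>H. w e' *
      (of_bool (e' \<in> F) + (\<Sum>e\<in>F - H. \<Sum>p\<in>P e. of_bool (e' \<in> path_edges p)) / real k))
    \<le> 2 * c * (\<Sum>e\<in>F. w e)" (is "?L \<le> _")
proof -
  have "?L = (\<Sum>e'\<in>H. w e' * of_bool (e' \<in> F)) +
      (\<Sum>e\<in>F - H. \<Sum>p\<in>P e. \<Sum>e'\<in>H. w e' * of_bool (e' \<in> path_edges p)) / real k"
    by (simp add: distrib_left sum.distrib sum_distrib_left sum_divide_distrib[symmetric]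
        sum.swap[of _ H])
  also have "\<dots> \<le> (\<Sum>e\<in>F \<inter> H. w e) + (\<Sum>e\<in>F - H. 2 * c * w e)"
  proof (rule add_mono)
    show "(\<Sum>e'\<in>H. w e' * of_bool (e' \<in> F)) \<le> (\<Sum>e\<in>F \<inter> H. w e)"
      using assms(2) by (simp add: of_bool_def if_distrib sum.If_cases Int_def conj_commute cong: if_cong)
    have "(\<Sum>p\<in>P e. \<Sum>e'\<in>H. w e' * of_bool (e' \<in> path_edges p)) \<le> real k * (2 * c * w e)"
      if e: "e \<in> F - H" for e
    proof -
      have "(\<Sum>e'\<in>H. w e' * of_bool (e' \<in> path_edges p)) \<le> c * w e" if "p \<in> P e" for p
      proof -
        have "H \<inter> {e'. e' \<in> path_edges p} = path_edges p" using P[OF e that] by auto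
        then show ?thesis
          using P[OF e that] assms(2)
          by (simp add: of_bool_def if_distrib sum.If_cases cong: if_cong)
      qed
      then have "(\<Sum>p\<in>P e. \<Sum>e'\<in>H. w e' * of_bool (e' \<in> path_edges p)) \<le> real (card (P e)) * (c * w e)"
        by (rule sum_bounded_above)
      then show ?thesis using card[OF e] by (simp add: mult_ac)
    qed
    then have "(\<Sum>e\<in>F - H. \<Sum>p\<in>P e. \<Sum>e'\<in>H. w e' * of_bool (e' \<in> path_edges p))
        \<le> (\<Sum>e\<in>F - H. real k * (2 * c * w e))" by (rule sum_mono)
    then show "(\<Sum>e\<in>F - H. \<Sum>p\<in>P e. \<Sum>e'\<in>H. w e' * of_bool (e' \<in> path_edges p)) / real k
        \<le> (\<Sum>e\<in>F - H. 2 * c * w e)"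
      using assms(3) by (simp add: sum_distrib_left[symmetric] field_simps)
  qed
  \<comment> \<open>Kept edges cost just their own weight; raising it to the common factor lets the
    two sums recombine over \<open>F\<close>.\<close>
  also have "\<dots> \<le> (\<Sum>e\<in>F \<inter> H. 2 * c * w e) + (\<Sum>e\<in>F - H. 2 * c * w e)"
  proof (intro add_right_mono sum_mono)
    fix e assume "e \<in> F \<inter> H"
    then have "1 * w e \<le> (2 * c) * w e" using assms(4) w0 by (intro mult_right_mono) auto
    then show "w e \<le> 2 * c * w e" by simp
  qed
  also have "\<dots> = 2 * c * (\<Sum>e\<in>F. w e)"
    using sum.Int_Diff[OF assms(1), of "\<lambda>e. 2 * c * w e" H] by (simp add: sum_distrib_left)
  finally show ?thesis .
qed

section \<open>The integral optimum and the final bound\<close>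

lemma vc_sndp_opt_attained:
  assumes "finite E" "vc_sndp_feasible V r E"
  obtains F where "F \<subseteq> E" "vc_sndp_feasible V r F" "vc_sndp_opt V E w r = (\<Sum>e\<in>F. w e)"
proof -
  let ?A = "{\<Sum>e\<in>F. w e | F. F \<subseteq> E \<and> vc_sndp_feasible V r F}"
  have "?A \<subseteq> sum w ` Pow E" by auto
  then have "finite ?A" using assms(1) by (meson finite_Pow_iff finite_imageI finite_subset)
  moreover have "?A \<noteq> {}" using assms(2) by auto
  ultimately have "Min ?A \<in> ?A" by (rule Min_in)
  then show ?thesis using that unfolding vc_sndp_opt_def by auto
qed

theorem theorem3p4:
  fixes V :: "'a set" and E H :: "'a set set" and w :: "'a set \<Rightarrow> real"
    and r :: "'a set \<Rightarrow> nat" and W T k t :: nat and f :: int and \<epsilon> :: real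
    and es :: "'a set list"
  assumes "simple_graph V E"
    and "w \<in> E \<rightarrow> real ` {0..W}"
    and "vc_sndp_feasible V r E"
    and "k = max_requirement V r"
    and "t \<ge> 1"
    and "f = (2 * int t - 2) * (2 * int k - 1)"
    and "\<epsilon> = 1 / (2 * real t - 1)"
    and "real ` {1..W} \<subseteq> (\<Union>i\<in>{1..T}. bucket \<epsilon> i)"
    and "distinct es" and "set es = E"
    and "H = streaming_vft_spanner V w T t f \<epsilon> es"
  shows "vc_sndp_lp_opt V H w (vc_deficiency V r) \<le> ereal (4 * real t * vc_sndp_opt V E w r)"
proof -
  have "finite V" "finite E" using assms(1,10) by (auto simp: simple_graph_def)
  have HE: "H \<subseteq> E"
    using assms(10,11) vft_fold_bucket by (fastforce simp: streaming_vft_spanner_def)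
  then have "finite H" using \<open>finite E\<close> finite_subset by blast
  obtain F where F: "F \<subseteq> E" "vc_sndp_feasible V r F" "vc_sndp_opt V E w r = (\<Sum>e\<in>F. w e)"
    using vc_sndp_opt_attained[OF \<open>finite E\<close> assms(3)] .
  have "finite F" using F \<open>finite E\<close> finite_subset by blast
  have F2: "\<forall>e\<in>F. card e = 2" using F assms(1) by (auto simp: simple_graph_def)
  have w0: "\<forall>e\<in>F. w e \<ge> 0" using F(1) funcset_mem[OF assms(2)] by fastforce
  have "\<exists>x. vc_sndp_lp_feasible V H (vc_deficiency V r) x \<and>
      (\<Sum>e\<in>H. w e * x e) \<le> 4 * real t * (\<Sum>e\<in>F. w e)"
  \<comment> \<open>For \<open>k = 0\<close> the share \<open>1 / k\<close> is meaningless and the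
    fault budget may be negative, but no deficiency is positive and the zero vector is
    feasible.\<close>
  proof (cases "k = 0")
    case True
    have "vc_deficiency V r (S, Sp) \<le> 0" if "(S, Sp) \<in> bisets V" for S Sp
    proof -
      have "r {u, v} = 0" if "v \<in> S" "u \<in> V - Sp" for u v
        using requirement_le_max_requirement[OF \<open>finite V\<close>, of u v r] that True assms(4)
          \<open>(S, Sp) \<in> bisets V\<close> by (auto simp: bisets_def)
      then show ?thesis using vc_deficiency_cases[OF \<open>finite V\<close> that, of r] by fastforce
    qed
    then have "vc_sndp_lp_feasible V H (vc_deficiency V r) (\<lambda>_. 0)"
      by (auto simp: vc_sndp_lp_feasible_def)
    moreover have "0 \<le> 4 * real t * (\<Sum>e\<in>F. w e)" using w0 by (simp add: sum_nonneg)
    ultimately show ?thesis by (intro exI[of _ "\<lambda>_. 0"]) simp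
  next
    case False
    then have "k \<ge> 1" by simp
    \<comment> \<open>Bundling all properties of a family into one predicate lets a single choice
      function \<open>P\<close> provide them together.\<close>
    define repl where "repl e P \<longleftrightarrow> (\<exists>u v. e = {u, v} \<and> finite P \<and> card P = 2 * k \<and>
      (\<forall>p\<in>P. is_path V H u v p \<and> (\<Sum>e'\<in>path_edges p. w e') \<le> 2 * real t * w e) \<and>
      pairwise (\<lambda>p q. internal_vertices p \<inter> internal_vertices q = {}) P)" for e P
    have "\<forall>e\<in>F - H. \<exists>P. repl e P"
    proof
      fix e assume "e \<in> F - H"
      then have "e \<in> E - H" using F(1) by blast
      then show "\<exists>P. repl e P"
        unfolding repl_def
        by (rule spanner_replacement_paths[OF assms(1,2,5) \<open>k \<ge> 1\<close> assms(6-8,10,11)])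
    qed
    then obtain P where "\<forall>e\<in>F - H. repl e (P e)" by metis
    note P = this[unfolded repl_def]
    let ?x = "\<lambda>e'. of_bool (e' \<in> F) +
      (\<Sum>e\<in>F - H. \<Sum>p\<in>P e. of_bool (e' \<in> path_edges p)) / real k"
    have "vc_sndp_lp_feasible V H (vc_deficiency V r) ?x"
    proof (rule lp_feasible_by_replacement[OF \<open>finite V\<close> \<open>finite F\<close> F2 F(2) assms(4) \<open>finite H\<close>])
      fix e assume "e \<in> F - H"
      from bspec[OF P this] obtain u v where "e = {u, v}" "finite (P e)" "card (P e) = 2 * k"
        "\<forall>p\<in>P e. is_path V H u v p"
        "pairwise (\<lambda>p q. internal_vertices p \<inter> internal_vertices q = {}) (P e)"
        by (elim exE conjE) simp
      then show "\<exists>u v. e = {u, v} \<and> finite (P e) \<and> card (P e) = 2 * k \<and>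
          (\<forall>p\<in>P e. is_path V H u v p) \<and>
          pairwise (\<lambda>p q. internal_vertices p \<inter> internal_vertices q = {}) (P e)"
        by (intro exI conjI)
    qed
    \<comment> \<open>The cost bound with \<open>c = 2 * real t\<close>; its factor
      \<open>2 * c\<close> is the claimed \<open>4 * real t\<close>.\<close>
    moreover have "(\<Sum>e'\<in>H. w e' * ?x e') \<le> 2 * (2 * real t) * (\<Sum>e\<in>F. w e)"
    proof (rule lp_cost_by_replacement[OF \<open>finite F\<close> \<open>finite H\<close> \<open>k \<ge> 1\<close> _ w0])
      show "path_edges p \<subseteq> H \<and> (\<Sum>e'\<in>path_edges p. w e') \<le> 2 * real t * w e"
        if "e \<in> F - H" "p \<in> P e" for e p
        using P that is_path_path_edges by metis
      show "card (P e) = 2 * k" if "e \<in> F - H" for e using P that by blast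
    qed (use \<open>t \<ge> 1\<close> in auto)
    ultimately show ?thesis by (intro exI[of _ ?x]) simp
  qed
  then obtain x where "vc_sndp_lp_feasible V H (vc_deficiency V r) x"
    and "(\<Sum>e\<in>H. w e * x e) \<le> 4 * real t * (\<Sum>e\<in>F. w e)" by blast
  then show ?thesis
    unfolding vc_sndp_lp_opt_def F(3) by (intro INF_lower2[of x]) auto
qed

end
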